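(* Let $\delta t>0$ be arbitrary and let the time-discrete scheme (S1)--(S5) with boundary conditions (BC) of the context be given. Then its solutions satisfy the modified energy law $$\begin{aligned} &\Big\{E_{tot}(\mathbf{u}^{k+1},\phi^{k+1})+\frac{\epsilon^{-1}}{4We^\ast}\|\phi^{k+1}-\phi^k\|_{L^2}^2+\frac{\delta t^2}{8}\|\nabla p^{k+1}\|_{L^2}^2\Big\}\\ &\quad-\Big\{E_{tot}(\mathbf{u}^{k},\phi^{k})+\frac{\epsilon^{-1}}{4We^\ast}\|\phi^{k}-\phi^{k-1}\|_{L^2}^2+\frac{\delta t^2}{8}\|\nabla p^{k}\|_{L^2}^2\Big\}\\ &=-\delta t\,\frac{\epsilon^{-1}}{We^\ast}\big\|\sqrt{M}\,\nabla\mu^{k+\frac12}\big\|_{L^2}^2-\delta t\,\frac{1}{Re}\big\|\nabla\overline{\mathbf{u}}^{k+\frac12}\big\|_{L^2}^2-\frac{\epsilon^{-1}}{4We^\ast}\big\|\phi^{k+1}-2\phi^k+\phi^{k-1}\big\|_{L^2}^2, \end{aligned}$$ where $M=M(\widetilde{\phi}^{k+\frac12})$. Thus the scheme is unconditionally stable, i.e. the modified energy in braces is non-increasing in $k$ with no restriction on $\delta t$.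
   Context: $\Omega\subseteq\mathbb{R}^d$ ($d=2,3$) is a bounded domain with unit outer normal $\mathbf{n}$ on $\partial\Omega$; $\epsilon, Re, We^\ast>0$ are constants (capillary width, Reynolds number, modified Weber number). The mobility $M$ is a function with $m_1\le M(\cdot)\le m_2$ for constants $0<m_1\le m_2$. The free energy density is $f_0(\phi)=\frac14(1-\phi^2)^2$ and the total energy is $$E_{tot}(\mathbf{u},\phi)=\int_\Omega\frac12|\mathbf{u}|^2\,dx+\frac1{We^\ast}\int_\Omega\Big(\frac1\epsilon f_0(\phi)+\frac\epsilon2|\nabla\phi|^2\Big)dx .$$ Notation: $\phi^{k+\frac12}=\frac12(\phi^{k+1}+\phi^k)$, $\widetilde{\phi}^{k+\frac12}=\frac{3\phi^k-\phi^{k-1}}{2}$, $\overline{\mathbf{u}}^{k+\frac12}=\frac{\overline{\mathbf{u}}^{k+1}+\mathbf{u}^k}{2}$, $\widetilde{\mathbf{u}}^{k+\frac12}=\frac{3\mathbf{u}^k-\mathbf{u}^{k-1}}{2}$, and $B(\mathbf{u},\mathbf{v})=(\mathbf{u}\cdot\nabla)\mathbf{v}+\frac12(\nabla\cdot\mathbf{u})\mathbf{v}$. Scheme: the step from $t^k=k\delta t$ to $t^{k+1}$ takes the data $\phi^k,\phi^{k-1},\mathbf{u}^k,\mathbf{u}^{k-1},p^k$ and produces $\phi^{k+1},\mu^{k+\frac12},\overline{\mathbf{u}}^{k+1},\mathbf{u}^{k+1},p^{k+1}$ satisfying in $\Omega$ (S1) $\dfrac{\phi^{k+1}-\phi^k}{\delta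 t}=\nabla\cdot\big(M(\widetilde{\phi}^{k+\frac12})\nabla\mu^{k+\frac12}-\widetilde{\phi}^{k+\frac12}\overline{\mathbf{u}}^{k+\frac12}\big)$, (S2) $\mu^{k+\frac12}=\frac12\big((\phi^{k+1})^2+(\phi^k)^2\big)\phi^{k+\frac12}-\widetilde{\phi}^{k+\frac12}-\epsilon^2\Delta\phi^{k+\frac12}$, (S3) $\dfrac{\overline{\mathbf{u}}^{k+1}-\mathbf{u}^k}{\delta t}-\dfrac1{Re}\Delta\overline{\mathbf{u}}^{k+\frac12}+B(\widetilde{\mathbf{u}}^{k+\frac12},\overline{\mathbf{u}}^{k+\frac12})=-\nabla p^k-\dfrac{\epsilon^{-1}}{We^\ast}\widetilde{\phi}^{k+\frac12}\nabla\mu^{k+\frac12}$, (S4) $\dfrac{\mathbf{u}^{k+1}-\overline{\mathbf{u}}^{k+1}}{\delta t}+\frac12\nabla(p^{k+1}-p^k)=0$, (S5) $\nabla\cdot\mathbf{u}^{k+1}=0$, with boundary conditions (BC) $\nabla\phi^{k+1}\cdot\mathbf{n}=0,\ \nabla\mu^{k+\frac12}\cdot\mathbf{n}=0,\ \overline{\mathbf{u}}^{k+\frac12}=0,\ \mathbf{u}^{k+1}\cdot\mathbf{n}=0$ on $\partial\Omega$. The phase data also satisfy $\nabla\phi^k\cdot\mathbf{n}=0$ on $\partial\Omega$, and the velocity data satisfy $\nabla\cdot\mathbf{u}^k=0$ in $\Omega$ and $\mathbf{u}^k\cdot\mathbf{n}=0$ on $\partial\Omega$ (as outputs of the preceding step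 or as admissible initial data). The scheme is understood in strong form: all functions, and the boundary of $\Omega$, are assumed regular enough for the equations to hold and for integration by parts to be valid. *)

theory Defs
  imports "HOL-Analysis.Analysis"
begin

section \<open>Differential operators and classical regularity\<close>

definition partial_deriv :: "'n \<Rightarrow> (real^'n::finite \<Rightarrow> 'b::real_normed_vector) \<Rightarrow> real^'n \<Rightarrow> 'b" where
  "partial_deriv i f x = frechet_derivative f (at x) (axis i 1)"

definition grad :: "(real^'n::finite \<Rightarrow> real) \<Rightarrow> real^'n \<Rightarrow> real^'n" where
  "grad f x = (\<chi> i. partial_deriv i f x)"

definition divergence :: "(real^'n::finite \<Rightarrow> real^'n) \<Rightarrow> real^'n \<Rightarrow> real" where
  "divergence F x = (\<Sum>i\<in>UNIV. partial_deriv i (\<lambda>y. F y $ i) x)"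

definition laplacian :: "(real^'n::finite \<Rightarrow> real) \<Rightarrow> real^'n \<Rightarrow> real" where
  "laplacian f x = divergence (grad f) x"

definition vec_laplacian :: "(real^'n::finite \<Rightarrow> real^'n) \<Rightarrow> real^'n \<Rightarrow> real^'n" where
  "vec_laplacian F x = (\<chi> j. laplacian (\<lambda>y. F y $ j) x)"

(* jacobian v (at x) has the entries d_j v_i (row i, column j), so that its product
   with u x is ((u . nabla) v)(x). *)
definition convection ::
  "(real^'n::finite \<Rightarrow> real^'n) \<Rightarrow> (real^'n \<Rightarrow> real^'n) \<Rightarrow> real^'n \<Rightarrow> real^'n" where
  "convection u v x = jacobian v (at x) *v u x + (divergence u x / 2) *\<^sub>R v x"

(* Classical regularity up to the boundary: C^1 resp. C^2 in an open neighbourhood of K,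
   where K is the closure of the flow domain. Gradients at boundary points are thereby
   ordinary gradients. *)
definition C1_on_nbhd :: "(real^'n::finite) set \<Rightarrow> (real^'n \<Rightarrow> 'b::real_normed_vector) \<Rightarrow> bool" where
  "C1_on_nbhd K f \<longleftrightarrow> (\<exists>U. open U \<and> K \<subseteq> U \<and> (\<forall>x\<in>U. f differentiable at x) \<and>
     (\<forall>i. continuous_on U (partial_deriv i f)))"

definition C2_on_nbhd :: "(real^'n::finite) set \<Rightarrow> (real^'n \<Rightarrow> 'b::real_normed_vector) \<Rightarrow> bool" where
  "C2_on_nbhd K f \<longleftrightarrow> C1_on_nbhd K f \<and> (\<forall>i. C1_on_nbhd K (partial_deriv i f))"

section \<open>Domains that admit integration by parts\<close>

(* Near x every proper subcone of the half-space of directions v with v . \<nu> < 0 lies in S,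
   and every proper subcone of the opposite one outside S; this determines \<nu> uniquely. *)
definition outer_unit_normal :: "(real^'n::finite) set \<Rightarrow> real^'n \<Rightarrow> real^'n \<Rightarrow> bool" where
  "outer_unit_normal S x \<nu> \<longleftrightarrow> norm \<nu> = 1 \<and>
     (\<forall>e>0. \<forall>\<^sub>F y in at x.
        ((y - x) \<bullet> \<nu> \<le> - e * norm (y - x) \<longrightarrow> y \<in> S) \<and>
        ((y - x) \<bullet> \<nu> \<ge> e * norm (y - x) \<longrightarrow> y \<notin> S))"

(* n is the unit outer normal field of S, and \<sigma> is the surface measure on the boundary:
   because n has length 1 almost everywhere, the Gauss formula determines \<sigma>.
   The null set of boundary points without a normal leaves room for edges and corners;
   there n carries no meaning (n = 0 makes a condition on a normal component void). *)
definition surface_measure ::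
  "(real^'n::finite) set \<Rightarrow> (real^'n \<Rightarrow> real^'n) \<Rightarrow> (real^'n) measure \<Rightarrow> bool" where
  "surface_measure S n \<sigma> \<longleftrightarrow>
     finite_measure \<sigma> \<and> sets \<sigma> = sets (restrict_space borel (frontier S)) \<and>
     n \<in> borel_measurable \<sigma> \<and> (AE x in \<sigma>. outer_unit_normal S x (n x)) \<and>
     (\<forall>F. C1_on_nbhd (closure S) F \<longrightarrow>
        (LINT x:S|lborel. divergence F x) = (LINT x|\<sigma>. F x \<bullet> n x))"

(* A bounded domain whose boundary is regular enough for integration by parts. *)
definition regular_domain :: "(real^'n::finite) set \<Rightarrow> (real^'n \<Rightarrow> real^'n) \<Rightarrow> bool" where
  "regular_domain S n \<longleftrightarrow>
     open S \<and> connected S \<and> bounded S \<and> S \<noteq> {} \<and> (\<exists>\<sigma>. surface_measure S n \<sigma>)"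

section \<open>Energies\<close>

definition L2_norm_on :: "(real^'n::finite) set \<Rightarrow> (real^'n \<Rightarrow> 'b::real_normed_vector) \<Rightarrow> real" where
  "L2_norm_on S f = sqrt (LINT x:S|lborel. (norm (f x))\<^sup>2)"

definition f0 :: "real \<Rightarrow> real" where
  "f0 s = (1 - s\<^sup>2)\<^sup>2 / 4"

definition E_tot ::
  "(real^'n::finite) set \<Rightarrow> real \<Rightarrow> real \<Rightarrow> (real^'n \<Rightarrow> real^'n) \<Rightarrow> (real^'n \<Rightarrow> real) \<Rightarrow> real" where
  "E_tot S \<epsilon> We u \<phi> =
     (LINT x:S|lborel. (norm (u x))\<^sup>2 / 2) +
     1 / We * (LINT x:S|lborel. 1 / \<epsilon> * f0 (\<phi> x) + \<epsilon> / 2 * (norm (grad \<phi> x))\<^sup>2)"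

(* \<phi>' is the phase field of the preceding time level. *)
definition E_mod ::
  "(real^'n::finite) set \<Rightarrow> real \<Rightarrow> real \<Rightarrow> real \<Rightarrow> (real^'n \<Rightarrow> real^'n) \<Rightarrow>
   (real^'n \<Rightarrow> real) \<Rightarrow> (real^'n \<Rightarrow> real) \<Rightarrow> (real^'n \<Rightarrow> real) \<Rightarrow> real" where
  "E_mod S \<epsilon> We \<delta>t u \<phi> \<phi>' p =
     E_tot S \<epsilon> We u \<phi> +
     inverse \<epsilon> / (4 * We) * (L2_norm_on S (\<lambda>x. \<phi> x - \<phi>' x))\<^sup>2 +
     \<delta>t\<^sup>2 / 8 * (L2_norm_on S (grad p))\<^sup>2"

section \<open>The scheme\<close>

definition midstep :: "('a \<Rightarrow> 'b::real_vector) \<Rightarrow> ('a \<Rightarrow> 'b) \<Rightarrow> 'a \<Rightarrow> 'b" where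
  "midstep f g x = (1/2) *\<^sub>R (f x + g x)"

definition extrapolate :: "('a \<Rightarrow> 'b::real_vector) \<Rightarrow> ('a \<Rightarrow> 'b) \<Rightarrow> 'a \<Rightarrow> 'b" where
  "extrapolate f g x = (1/2) *\<^sub>R (3 *\<^sub>R f x - g x)"

(* Data for the step that leaves time level 1; (\<phi>0, u0) belong to time level 0. *)
definition admissible_data ::
  "(real^'n::finite) set \<Rightarrow> (real^'n \<Rightarrow> real^'n) \<Rightarrow>
   (real^'n \<Rightarrow> real) \<Rightarrow> (real^'n \<Rightarrow> real) \<Rightarrow> (real^'n \<Rightarrow> real^'n) \<Rightarrow> (real^'n \<Rightarrow> real^'n) \<Rightarrow>
   (real^'n \<Rightarrow> real) \<Rightarrow> bool" where
  "admissible_data S n \<phi>0 \<phi>1 u0 u1 p1 \<longleftrightarrow>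
     C2_on_nbhd (closure S) \<phi>0 \<and> C2_on_nbhd (closure S) \<phi>1 \<and>
     C1_on_nbhd (closure S) u0 \<and> C1_on_nbhd (closure S) u1 \<and>
     C1_on_nbhd (closure S) p1 \<and>
     (\<forall>x\<in>frontier S. grad \<phi>1 x \<bullet> n x = 0) \<and>
     (\<forall>x\<in>S. divergence u1 x = 0) \<and>
     (\<forall>x\<in>frontier S. u1 x \<bullet> n x = 0)"

(* The step from level k to level k + 1, where k >= 1. Half-integer levels are rounded down:
   \<mu> k stands for mu^(k+1/2); ub is the intermediate velocity (u with an overline).
   The mobility M needs no regularity beyond that of the diffusive flux. *)
definition scheme_step ::
  "(real^'n::finite) set \<Rightarrow> (real^'n \<Rightarrow> real^'n) \<Rightarrow> (real \<Rightarrow> real) \<Rightarrow>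
   real \<Rightarrow> real \<Rightarrow> real \<Rightarrow> real \<Rightarrow>
   (nat \<Rightarrow> real^'n \<Rightarrow> real) \<Rightarrow> (nat \<Rightarrow> real^'n \<Rightarrow> real) \<Rightarrow>
   (nat \<Rightarrow> real^'n \<Rightarrow> real^'n) \<Rightarrow> (nat \<Rightarrow> real^'n \<Rightarrow> real^'n) \<Rightarrow> (nat \<Rightarrow> real^'n \<Rightarrow> real) \<Rightarrow>
   nat \<Rightarrow> bool" where
  "scheme_step S n M \<epsilon> Rey We \<delta>t \<phi> \<mu> ub u p k \<longleftrightarrow>
    (let \<phi>h = midstep (\<phi> (k + 1)) (\<phi> k);
         \<phi>t = extrapolate (\<phi> k) (\<phi> (k - 1));
         uh = midstep (ub (k + 1)) (u k);
         ut = extrapolate (u k) (u (k - 1))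
     in
     C2_on_nbhd (closure S) (\<phi> (k + 1)) \<and>
     C1_on_nbhd (closure S) (\<mu> k) \<and>
     C1_on_nbhd (closure S) (\<lambda>y. M (\<phi>t y) *\<^sub>R grad (\<mu> k) y) \<and>
     C2_on_nbhd (closure S) uh \<and>
     C1_on_nbhd (closure S) (u (k + 1)) \<and>
     C1_on_nbhd (closure S) (p (k + 1)) \<and>
     (\<forall>x\<in>S. (\<phi> (k + 1) x - \<phi> k x) / \<delta>t =
        divergence (\<lambda>y. M (\<phi>t y) *\<^sub>R grad (\<mu> k) y - \<phi>t y *\<^sub>R uh y) x) \<and>
     (\<forall>x\<in>S. \<mu> k x =
        1/2 * ((\<phi> (k + 1) x)\<^sup>2 + (\<phi> k x)\<^sup>2) * \<phi>h x - \<phi>t x - \<epsilon>\<^sup>2 * laplacian \<phi>h x) \<and>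
     (\<forall>x\<in>S. (1 / \<delta>t) *\<^sub>R (ub (k + 1) x - u k x) - (1 / Rey) *\<^sub>R vec_laplacian uh x
          + convection ut uh x =
        - grad (p k) x - (inverse \<epsilon> / We * \<phi>t x) *\<^sub>R grad (\<mu> k) x) \<and>
     (\<forall>x\<in>S. (1 / \<delta>t) *\<^sub>R (u (k + 1) x - ub (k + 1) x)
          + (1/2) *\<^sub>R grad (\<lambda>y. p (k + 1) y - p k y) x = 0) \<and>
     (\<forall>x\<in>S. divergence (u (k + 1)) x = 0) \<and>
     (\<forall>x\<in>frontier S. grad (\<phi> (k + 1)) x \<bullet> n x = 0) \<and>
     (\<forall>x\<in>frontier S. grad (\<mu> k) x \<bullet> n x = 0) \<and>
     (\<forall>x\<in>frontier S. uh x = 0) \<and>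
     (\<forall>x\<in>frontier S. u (k + 1) x \<bullet> n x = 0))"

end

theory Submission
  imports Defs
begin

text \<open>
  The law is the integral of a pointwise identity. Test the transport equation with \<open>\<mu>\<close>, the
  definition of \<open>\<mu>\<close> with the increment of the phase field, and the momentum equation with the
  midpoint velocity. After every product has been rewritten by the product rule, the increment of
  the modified energy density plus the dissipation density is a linear combination of the
  divergences of six \<open>C\<^sup>1\<close> vector fields (lemma \<open>energy_density_balance\<close>). Each of these fields has
  no normal component on the boundary, by the boundary conditions, so the Gauss formula makes its
  divergence integrate to zero (lemma \<open>integral_divergence_eq_0\<close>), and the law remains.

  Three features of the scheme make the pointwise identity exact rather than an inequality, for
  every time step. (1) The averaged cubic term is a discrete gradient of the quartic part of the
  double well, and the extrapolated linear term deviates from the midpoint rule by a second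
  difference of the phase field, which splits by polarization into the increment of a square and a
  dissipated square (\<open>double_well_increment\<close>). (2) The pressure correction expresses the
  intermediate velocity by the new one and a pressure gradient; the explicit pressure then
  contributes an increment of \<open>\<delta>t\<^sup>2 / 8 * (norm (grad p))\<^sup>2\<close> and the products of the
  pressure gradient and the velocity at the new and at the old level, which are divergences because
  these velocities are solenoidal (\<open>projection_increment\<close>).
  (3) The skew-symmetric convection term tested with the transported field is a divergence
  (\<open>convection_inner_self\<close>), and the capillary force cancels the convective part of the phase
  transport, because both use the same extrapolated phase field and the same velocity.

  A step turns admissible data into admissible data for the next step, so the one-step law holds at
  every level; its right-hand side is nonpositive, which gives the monotonicity.
\<close>

section \<open>Calculus of partial derivatives\<close>

lemma partial_deriv_eqI:
  assumes "(f has_derivative f') (at x)"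
  shows "partial_deriv i f x = f' (axis i 1)"
  using frechet_derivative_at[OF assms] by (simp add: partial_deriv_def)

lemma partial_deriv_cong:
  assumes "open U" "x \<in> U" "\<And>y. y \<in> U \<Longrightarrow> f y = g y"
  shows "partial_deriv i f x = partial_deriv i g x"
proof -
  have "(f has_derivative D) (at x) \<longleftrightarrow> (g has_derivative D) (at x)" for D
    using has_derivative_transform_within_open[OF _ assms(1,2), of f D UNIV g]
      has_derivative_transform_within_open[OF _ assms(1,2), of g D UNIV f] assms(3)
    by auto
  then show ?thesis
    by (simp add: partial_deriv_def frechet_derivative_def)
qed

lemma partial_deriv_bounded_linear:
  assumes "bounded_linear h" "f differentiable at x"
  shows "partial_deriv i (\<lambda>y. h (f y)) x = h (partial_deriv i f x)"
proof -
  have "((\<lambda>y. h (f y)) has_derivative (\<lambda>v. h (frechet_derivative f (at x) v))) (at x)"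
    using assms(2)
    by (intro bounded_linear.has_derivative[OF assms(1)]) (simp flip: frechet_derivative_works)
  from partial_deriv_eqI[OF this] show ?thesis
    by (simp add: partial_deriv_def)
qed

lemma partial_deriv_bounded_bilinear:
  assumes "bounded_bilinear prd" "f differentiable at x" "g differentiable at x"
  shows "partial_deriv i (\<lambda>y. prd (f y) (g y)) x
    = prd (f x) (partial_deriv i g x) + prd (partial_deriv i f x) (g x)"
proof -
  have "((\<lambda>y. prd (f y) (g y)) has_derivative
      (\<lambda>v. prd (f x) (frechet_derivative g (at x) v) + prd (frechet_derivative f (at x) v) (g x))) (at x)"
    using assms(2,3)
    by (intro bounded_bilinear.FDERIV[OF assms(1)]) (simp_all flip: frechet_derivative_works)
  from partial_deriv_eqI[OF this] show ?thesis
    by (simp add: partial_deriv_def)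
qed

lemma partial_deriv_add:
  assumes "f differentiable at x" "g differentiable at x"
  shows "partial_deriv i (\<lambda>y. f y + g y) x = partial_deriv i f x + partial_deriv i g x"
proof -
  have "((\<lambda>y. f y + g y) has_derivative
      (\<lambda>v. frechet_derivative f (at x) v + frechet_derivative g (at x) v)) (at x)"
    using assms by (intro has_derivative_add) (simp_all flip: frechet_derivative_works)
  from partial_deriv_eqI[OF this] show ?thesis
    by (simp add: partial_deriv_def)
qed

lemma partial_deriv_const: "partial_deriv i (\<lambda>y. c) x = 0"
  using partial_deriv_eqI[OF has_derivative_const] .

lemma differentiable_bounded_bilinear:
  assumes "bounded_bilinear prd" "f differentiable at x" "g differentiable at x"
  shows "(\<lambda>y. prd (f y) (g y)) differentiable at x"
  using bounded_bilinear.FDERIV[OF assms(1)] assms(2,3)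
  unfolding differentiable_def by blast

lemma differentiable_bounded_linear:
  assumes "bounded_linear h" "f differentiable at x"
  shows "(\<lambda>y. h (f y)) differentiable at x"
  using bounded_linear.has_derivative[OF assms(1)] assms(2)
  unfolding differentiable_def by blast

section \<open>Functions of class C1 and C2 up to the boundary\<close>

text \<open>
  Formulas for partial derivatives hold only where the functions are differentiable, that is, on
  some neighbourhood of \<open>K\<close>; this lemma transfers regularity along such local equalities.
\<close>

lemma C1_on_nbhd_cong:
  assumes "C1_on_nbhd K f" "open V" "K \<subseteq> V" "\<And>x. x \<in> V \<Longrightarrow> f x = g x"
  shows "C1_on_nbhd K g"
proof -
  obtain U where U: "open U" "K \<subseteq> U" "\<And>x. x \<in> U \<Longrightarrow> f differentiable at x"
    "\<And>i. continuous_on U (partial_deriv i f)"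
    using assms(1) unfolding C1_on_nbhd_def by blast
  have "g differentiable at x" if "x \<in> U \<inter> V" for x
    using U(3)[of x] that has_derivative_transform_within_open[OF _ assms(2), of f _ x UNIV g] assms(4)
    unfolding differentiable_def by blast
  moreover have "continuous_on (U \<inter> V) (partial_deriv i g)" for i
  proof -
    have "continuous_on (U \<inter> V) (partial_deriv i f)"
      using U(4) continuous_on_subset by blast
    then show ?thesis
      by (rule continuous_on_eq) (auto intro!: partial_deriv_cong[OF assms(2)] assms(4))
  qed
  ultimately show ?thesis
    unfolding C1_on_nbhd_def using U(1,2) assms(2,3) by (intro exI[of _ "U \<inter> V"]) auto
qed

lemma C1_on_nbhd_common:
  assumes "C1_on_nbhd K f" "C1_on_nbhd K g"
  shows "\<exists>U. open U \<and> K \<subseteq> U \<and>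
    (\<forall>x\<in>U. f differentiable at x \<and> g differentiable at x) \<and>
    (\<forall>i. continuous_on U (partial_deriv i f) \<and> continuous_on U (partial_deriv i g))"
proof -
  obtain U V where "open U" "K \<subseteq> U" "\<forall>x\<in>U. f differentiable at x"
    and "open V" "K \<subseteq> V" "\<forall>x\<in>V. g differentiable at x"
    and "\<forall>i. continuous_on U (partial_deriv i f)" "\<forall>i. continuous_on V (partial_deriv i g)"
    using assms unfolding C1_on_nbhd_def by blast
  moreover from this have "\<forall>i. continuous_on (U \<inter> V) (partial_deriv i f)
      \<and> continuous_on (U \<inter> V) (partial_deriv i g)"
    by (meson continuous_on_subset inf_le1 inf_le2)
  ultimately show ?thesis
    by (intro exI[of _ "U \<inter> V"]) auto
qed

lemma C1_on_nbhd_differentiable: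
  "C1_on_nbhd K f \<Longrightarrow> x \<in> K \<Longrightarrow> f differentiable at x"
  unfolding C1_on_nbhd_def by blast

lemma C1_on_nbhd_continuous: "C1_on_nbhd K f \<Longrightarrow> continuous_on K f"
  by (intro continuous_at_imp_continuous_on ballI differentiable_imp_continuous_within
      C1_on_nbhd_differentiable)

lemma C1_on_nbhd_continuous_partial_deriv:
  "C1_on_nbhd K f \<Longrightarrow> continuous_on K (partial_deriv i f)"
  unfolding C1_on_nbhd_def using continuous_on_subset by blast

lemma C1_on_nbhd_bounded_linear:
  assumes "bounded_linear h" "C1_on_nbhd K f"
  shows "C1_on_nbhd K (\<lambda>x. h (f x))"
proof -
  obtain U where U: "open U" "K \<subseteq> U" "\<And>x. x \<in> U \<Longrightarrow> f differentiable at x"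
    "\<And>i. continuous_on U (partial_deriv i f)"
    using assms(2) unfolding C1_on_nbhd_def by blast
  have "continuous_on U (partial_deriv i (\<lambda>x. h (f x)))" for i
  proof -
    have "continuous_on U (\<lambda>x. h (partial_deriv i f x))"
      using U(4) by (intro bounded_linear.continuous_on[OF assms(1)])
    then show ?thesis
      by (rule continuous_on_eq) (simp add: partial_deriv_bounded_linear[OF assms(1)] U(3))
  qed
  then show ?thesis
    unfolding C1_on_nbhd_def using U differentiable_bounded_linear[OF assms(1), of f] by (intro exI[of _ U]) simp
qed

lemma C1_on_nbhd_bounded_bilinear:
  assumes "bounded_bilinear prd" "C1_on_nbhd K f" "C1_on_nbhd K g"
  shows "C1_on_nbhd K (\<lambda>x. prd (f x) (g x))"
proof -
  obtain U where U: "open U" "K \<subseteq> U"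
    and diff: "\<forall>x\<in>U. f differentiable at x \<and> g differentiable at x"
    and cont': "\<forall>i. continuous_on U (partial_deriv i f) \<and> continuous_on U (partial_deriv i g)"
    using C1_on_nbhd_common[OF assms(2,3)] by (elim exE conjE)
  have cont: "continuous_on U f" "continuous_on U g"
    using diff by (auto intro!: continuous_at_imp_continuous_on differentiable_imp_continuous_within)
  have "continuous_on U (partial_deriv i (\<lambda>x. prd (f x) (g x)))" for i
  proof -
    have "continuous_on U (\<lambda>x. prd (f x) (partial_deriv i g x) + prd (partial_deriv i f x) (g x))"
      using cont' cont by (intro continuous_on_add bounded_bilinear.continuous_on[OF assms(1)]) simp_all
    then show ?thesis
      by (rule continuous_on_eq) (simp add: partial_deriv_bounded_bilinear[OF assms(1)] diff)
  qed
  then show ?thesis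
    unfolding C1_on_nbhd_def using U diff differentiable_bounded_bilinear[OF assms(1), of f _ g] by (intro exI[of _ U]) simp
qed

lemma C1_on_nbhd_add:
  assumes "C1_on_nbhd K f" "C1_on_nbhd K g"
  shows "C1_on_nbhd K (\<lambda>x. f x + g x)"
proof -
  obtain U where U: "open U" "K \<subseteq> U"
    and diff: "\<forall>x\<in>U. f differentiable at x \<and> g differentiable at x"
    and cont: "\<forall>i. continuous_on U (partial_deriv i f) \<and> continuous_on U (partial_deriv i g)"
    using C1_on_nbhd_common[OF assms] by (elim exE conjE)
  have "continuous_on U (partial_deriv i (\<lambda>x. f x + g x))" for i
    using cont diff
    by (rule_tac continuous_on_eq[OF continuous_on_add[of U "partial_deriv i f" "partial_deriv i g"]])
      (simp_all add: partial_deriv_add)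
  then show ?thesis
    unfolding C1_on_nbhd_def using U diff by (intro exI[of _ U]) simp
qed

lemmas C1_on_nbhd_scaleR_const = C1_on_nbhd_bounded_linear[OF bounded_linear_scaleR_right]
lemmas C1_on_nbhd_component = C1_on_nbhd_bounded_linear[OF bounded_linear_vec_nth]
lemmas C1_on_nbhd_scaleR = C1_on_nbhd_bounded_bilinear[OF bounded_bilinear_scaleR]
lemmas C1_on_nbhd_inner = C1_on_nbhd_bounded_bilinear[OF bounded_bilinear_inner]

lemma C1_on_nbhd_diff:
  assumes "C1_on_nbhd K f" "C1_on_nbhd K g"
  shows "C1_on_nbhd K (\<lambda>x. f x - g x)"
  using C1_on_nbhd_add[OF assms(1) C1_on_nbhd_scaleR_const[OF assms(2), of "-1"]] by simp

lemma C1_on_nbhd_const: "C1_on_nbhd K (\<lambda>x. c)"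
  unfolding C1_on_nbhd_def
  by (intro exI[of _ UNIV]) (auto simp: partial_deriv_const[abs_def])

lemma C1_on_nbhd_sum:
  assumes "finite I" "\<And>i. i \<in> I \<Longrightarrow> C1_on_nbhd K (f i)"
  shows "C1_on_nbhd K (\<lambda>x. \<Sum>i\<in>I. f i x)"
  using assms by (induction I) (auto intro: C1_on_nbhd_const C1_on_nbhd_add)

lemma C1_on_nbhd_vec:
  fixes f :: "'m::finite \<Rightarrow> real^'n::finite \<Rightarrow> real"
  assumes "\<And>i. C1_on_nbhd K (f i)"
  shows "C1_on_nbhd K (\<lambda>x. \<chi> i. f i x)"
proof -
  have "(\<lambda>x. \<chi> i. f i x) = (\<lambda>x. \<Sum>i\<in>UNIV. f i x *\<^sub>R axis i (1::real))"
    using basis_expansion[of "\<chi> i. f i _"] by (simp add: scalar_mult_eq_scaleR)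
  moreover have "C1_on_nbhd K (\<lambda>x. \<Sum>i\<in>UNIV. f i x *\<^sub>R axis i (1::real))"
    using assms by (intro C1_on_nbhd_sum C1_on_nbhd_bounded_linear[OF bounded_linear_scaleR_left]) auto
  ultimately show ?thesis by simp
qed

lemma C2_on_nbhd_bounded_linear:
  assumes "bounded_linear h" "C2_on_nbhd K f"
  shows "C2_on_nbhd K (\<lambda>x. h (f x))"
proof -
  obtain U where U: "open U" "K \<subseteq> U" "\<And>x. x \<in> U \<Longrightarrow> f differentiable at x"
    using assms(2) unfolding C2_on_nbhd_def C1_on_nbhd_def by blast
  have "C1_on_nbhd K (partial_deriv i (\<lambda>x. h (f x)))" for i
    using assms(2) U(3) unfolding C2_on_nbhd_def
    by (rule_tac C1_on_nbhd_cong[OF C1_on_nbhd_bounded_linear[OF assms(1)] U(1,2)])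
      (auto simp: partial_deriv_bounded_linear[OF assms(1)])
  then show ?thesis
    using assms C1_on_nbhd_bounded_linear[OF assms(1), of K f] unfolding C2_on_nbhd_def by simp
qed

lemma C2_on_nbhd_add:
  assumes "C2_on_nbhd K f" "C2_on_nbhd K g"
  shows "C2_on_nbhd K (\<lambda>x. f x + g x)"
proof -
  obtain U where U: "open U" "K \<subseteq> U"
    and diff: "\<forall>x\<in>U. f differentiable at x \<and> g differentiable at x"
    using C1_on_nbhd_common[of K f g] assms unfolding C2_on_nbhd_def by (elim exE conjE) auto
  have "C1_on_nbhd K (partial_deriv i (\<lambda>x. f x + g x))" for i
    using assms diff unfolding C2_on_nbhd_def
    by (rule_tac C1_on_nbhd_cong[OF C1_on_nbhd_add U(1,2)]) (auto simp: partial_deriv_add)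
  then show ?thesis
    using assms C1_on_nbhd_add[of K f g] unfolding C2_on_nbhd_def by simp
qed

lemma C2_on_nbhd_imp_C1: "C2_on_nbhd K f \<Longrightarrow> C1_on_nbhd K f"
  by (simp add: C2_on_nbhd_def)

lemma C2_on_nbhd_grad: "C2_on_nbhd K f \<Longrightarrow> C1_on_nbhd K (grad f)"
  unfolding grad_def[abs_def] C2_on_nbhd_def by (intro C1_on_nbhd_vec) auto

lemma C2_on_nbhd_midstep:
  "C2_on_nbhd K f \<Longrightarrow> C2_on_nbhd K g \<Longrightarrow> C2_on_nbhd K (midstep f g)"
  unfolding midstep_def[abs_def]
  by (intro C2_on_nbhd_bounded_linear[OF bounded_linear_scaleR_right] C2_on_nbhd_add)

lemma C1_on_nbhd_extrapolate:
  "C1_on_nbhd K f \<Longrightarrow> C1_on_nbhd K g \<Longrightarrow> C1_on_nbhd K (extrapolate f g)"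
  unfolding extrapolate_def[abs_def] by (intro C1_on_nbhd_scaleR_const C1_on_nbhd_diff)

lemma C1_on_nbhd_continuous_grad:
  "C1_on_nbhd K f \<Longrightarrow> continuous_on K (grad f)"
  unfolding grad_def[abs_def]
  by (intro continuous_on_vec_lambda C1_on_nbhd_continuous_partial_deriv)

lemma C1_on_nbhd_continuous_divergence:
  "C1_on_nbhd K F \<Longrightarrow> continuous_on K (divergence F)"
  unfolding divergence_def[abs_def]
  by (intro continuous_on_sum C1_on_nbhd_continuous_partial_deriv C1_on_nbhd_component)

section \<open>Product rules\<close>

lemma divergence_eq:
  "F differentiable at x \<Longrightarrow> divergence F x = (\<Sum>i\<in>UNIV. partial_deriv i F x $ i)"
  unfolding divergence_def by (simp add: partial_deriv_bounded_linear[OF bounded_linear_vec_nth])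

lemma divergence_scaleR:
  assumes "f differentiable at x" "F differentiable at x"
  shows "divergence (\<lambda>y. f y *\<^sub>R F y) x = grad f x \<bullet> F x + f x * divergence F x"
proof -
  have "divergence (\<lambda>y. f y *\<^sub>R F y) x = (\<Sum>i\<in>UNIV. partial_deriv i (\<lambda>y. f y *\<^sub>R F y) x $ i)"
    using assms by (intro divergence_eq differentiable_bounded_bilinear[OF bounded_bilinear_scaleR])
  then show ?thesis
    using assms
    by (simp add: partial_deriv_bounded_bilinear[OF bounded_bilinear_scaleR] divergence_eq
        grad_def inner_vec_def sum.distrib sum_distrib_left)
qed

lemma grad_add:
  "f differentiable at x \<Longrightarrow> g differentiable at x \<Longrightarrow>
    grad (\<lambda>y. f y + g y) x = grad f x + grad g x"
  by (simp add: grad_def partial_deriv_add vec_eq_iff)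

lemma grad_scaleR_const:
  "f differentiable at x \<Longrightarrow> grad (\<lambda>y. c *\<^sub>R f y) x = c *\<^sub>R grad f x"
  unfolding grad_def
  by (simp add: vec_eq_iff partial_deriv_bounded_linear[OF bounded_linear_scaleR_right, of f] del: real_scaleR_def)

lemma grad_diff:
  assumes "f differentiable at x" "g differentiable at x"
  shows "grad (\<lambda>y. f y - g y) x = grad f x - grad g x"
  using assms grad_add[of f x "\<lambda>y. (-1) *\<^sub>R g y"] grad_scaleR_const[of g x "-1"]
  by simp

lemma grad_midstep:
  assumes "f differentiable at x" "g differentiable at x"
  shows "grad (midstep f g) x = (1/2) *\<^sub>R (grad f x + grad g x)"
  unfolding midstep_def[abs_def]
  using assms by (simp only: grad_scaleR_const grad_add differentiable_add)

lemma jacobian_component: "jacobian F (at x) $ j $ i = partial_deriv i F x $ j"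
  by (simp add: jacobian_def matrix_def partial_deriv_def)

lemma norm_jacobian_squared:
  "(norm (jacobian F (at x)))\<^sup>2 = (\<Sum>i\<in>UNIV. partial_deriv i F x \<bullet> partial_deriv i F x)"
  unfolding power2_norm_eq_inner inner_vec_def jacobian_component by (rule sum.swap)

lemma continuous_on_jacobian:
  "C1_on_nbhd K F \<Longrightarrow> continuous_on K (\<lambda>x. (norm (jacobian F (at x)))\<^sup>2)"
  unfolding norm_jacobian_squared
  by (intro continuous_on_sum continuous_on_inner C1_on_nbhd_continuous_partial_deriv)

text \<open>
  Since the gradient of \<open>v \<bullet> v\<close> is twice the transposed Jacobian applied to \<open>v\<close>, the half divergence
  in the convection term is exactly what completes the product rule for \<open>(v \<bullet> v) u\<close>.
\<close>

lemma convection_inner_self: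
  assumes "u differentiable at x" "v differentiable at x"
  shows "convection u v x \<bullet> v x = divergence (\<lambda>y. (v y \<bullet> v y) *\<^sub>R u y) x / 2"
proof -
  have grad: "grad (\<lambda>y. v y \<bullet> v y) x \<bullet> u x = 2 * ((jacobian v (at x) *v u x) \<bullet> v x)"
  proof -
    have "grad (\<lambda>y. v y \<bullet> v y) x $ i = v x \<bullet> partial_deriv i v x + partial_deriv i v x \<bullet> v x" for i
      unfolding grad_def vec_lambda_beta
      by (intro partial_deriv_bounded_bilinear[OF bounded_bilinear_inner] assms(2))
    then have "grad (\<lambda>y. v y \<bullet> v y) x $ i = 2 * (\<Sum>j\<in>UNIV. jacobian v (at x) $ j $ i * v x $ j)" for i
      unfolding inner_commute[of "v x"] by (simp add: jacobian_component inner_vec_def)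
    then have "grad (\<lambda>y. v y \<bullet> v y) x \<bullet> u x
        = (\<Sum>i\<in>UNIV. \<Sum>j\<in>UNIV. 2 * (jacobian v (at x) $ j $ i * u x $ i * v x $ j))"
      by (simp add: inner_vec_def sum_distrib_left sum_distrib_right mult_ac)
    also have "\<dots> = (\<Sum>j\<in>UNIV. \<Sum>i\<in>UNIV. 2 * (jacobian v (at x) $ j $ i * u x $ i * v x $ j))"
      by (rule sum.swap)
    also have "\<dots> = 2 * ((jacobian v (at x) *v u x) \<bullet> v x)"
      by (simp add: inner_vec_def matrix_vector_mult_def sum_distrib_left sum_distrib_right mult_ac)
    finally show ?thesis .
  qed
  have "(\<lambda>y. v y \<bullet> v y) differentiable at x"
    using assms by (intro differentiable_bounded_bilinear[OF bounded_bilinear_inner])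
  then have "divergence (\<lambda>y. (v y \<bullet> v y) *\<^sub>R u y) x
      = grad (\<lambda>y. v y \<bullet> v y) x \<bullet> u x + (v x \<bullet> v x) * divergence u x"
    using assms(1) by (rule divergence_scaleR)
  then show ?thesis
    unfolding grad convection_def by (simp add: inner_add_left)
qed

text \<open>
  The transposed Jacobian applied to \<open>v\<close>, or half the gradient of \<open>v \<bullet> v\<close>: the boundary term of
  Green's first identity for the vector Laplacian.
\<close>

definition viscous_flux :: "(real^'n::finite \<Rightarrow> real^'n) \<Rightarrow> real^'n \<Rightarrow> real^'n" where
  "viscous_flux v x = (\<chi> i. v x \<bullet> partial_deriv i v x)"

lemma C1_on_nbhd_viscous_flux: "C2_on_nbhd K v \<Longrightarrow> C1_on_nbhd K (viscous_flux v)"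
  unfolding viscous_flux_def[abs_def] C2_on_nbhd_def
  by (intro C1_on_nbhd_vec C1_on_nbhd_inner) auto

text \<open>Green's first identity before integration.\<close>

lemma vec_laplacian_inner_self:
  assumes "C2_on_nbhd K v" "x \<in> K"
  shows "vec_laplacian v x \<bullet> v x = divergence (viscous_flux v) x - (norm (jacobian v (at x)))\<^sup>2"
proof -
  obtain U where U: "open U" "K \<subseteq> U" "\<And>x. x \<in> U \<Longrightarrow> v differentiable at x"
    using assms(1) unfolding C2_on_nbhd_def C1_on_nbhd_def by blast
  have dd: "partial_deriv i v differentiable at x" for i
    using assms C1_on_nbhd_differentiable unfolding C2_on_nbhd_def by blast
  have "partial_deriv i (partial_deriv i (\<lambda>z. v z $ j)) x = partial_deriv i (partial_deriv i v) x $ j" for i j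
  proof -
    have "partial_deriv i (partial_deriv i (\<lambda>z. v z $ j)) x
        = partial_deriv i (\<lambda>y. partial_deriv i v y $ j) x"
      using U assms(2)
      by (intro partial_deriv_cong[OF U(1)]) (auto simp: partial_deriv_bounded_linear[OF bounded_linear_vec_nth])
    also have "\<dots> = partial_deriv i (partial_deriv i v) x $ j"
      using dd by (intro partial_deriv_bounded_linear[OF bounded_linear_vec_nth])
    finally show ?thesis .
  qed
  then have "vec_laplacian v x $ j = (\<Sum>i\<in>UNIV. partial_deriv i (partial_deriv i v) x) $ j" for j
    by (simp add: vec_laplacian_def laplacian_def divergence_def grad_def)
  then have lap: "vec_laplacian v x = (\<Sum>i\<in>UNIV. partial_deriv i (partial_deriv i v) x)"
    by (simp add: vec_eq_iff)
  have "divergence (viscous_flux v) x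
      = (\<Sum>i\<in>UNIV. v x \<bullet> partial_deriv i (partial_deriv i v) x + partial_deriv i v x \<bullet> partial_deriv i v x)"
    using dd U assms(2)
    by (auto simp: divergence_def viscous_flux_def subset_eq
        intro!: sum.cong partial_deriv_bounded_bilinear[OF bounded_bilinear_inner])
  then show ?thesis
    by (simp add: lap norm_jacobian_squared sum.distrib inner_sum_right inner_commute[of _ "v x"])
qed

section \<open>Integration over a regular domain\<close>

lemma set_integrable_continuous_closure:
  fixes f :: "real^'n::finite \<Rightarrow> real"
  assumes "bounded S" "open S" "continuous_on (closure S) f"
  shows "set_integrable lborel S f"
proof -
  have "set_integrable lborel (closure S) f"
    unfolding set_integrable_def
    using assms by (intro borel_integrable_compact) auto
  then show ?thesis
    using assms(2) closure_subset by (rule_tac set_integrable_subset) auto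
qed

text \<open>
  A condition imposed at every boundary point suffices because the surface measure lives on the
  frontier.
\<close>

lemma integral_divergence_eq_0:
  assumes "regular_domain S n" "C1_on_nbhd (closure S) F" "\<And>x. x \<in> frontier S \<Longrightarrow> F x \<bullet> n x = 0"
  shows "(LINT x:S|lborel. divergence F x) = 0"
proof -
  obtain \<sigma> where \<sigma>: "surface_measure S n \<sigma>"
    using assms(1) unfolding regular_domain_def by blast
  then have "space \<sigma> = frontier S"
    using sets_eq_imp_space_eq[of \<sigma> "restrict_space borel (frontier S)"]
    by (simp add: surface_measure_def space_restrict_space)
  then have "(LINT x|\<sigma>. F x \<bullet> n x) = (LINT x|\<sigma>. 0)"
    using assms(3) by (intro Bochner_Integration.integral_cong) auto
  then show ?thesis
    using \<sigma> assms(2) by (simp add: surface_measure_def)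
qed

lemma L2_norm_on_squared:
  "(L2_norm_on S f)\<^sup>2 = (LINT x:S|lborel. (norm (f x))\<^sup>2)"
  unfolding L2_norm_on_def
  by (simp add: set_lebesgue_integral_def)

section \<open>Algebraic identities behind the scheme\<close>

text \<open>
  With \<open>a\<close>, \<open>b\<close>, \<open>c\<close> the phase values at three successive levels, newest first, the cubic average
  times \<open>a - b\<close> telescopes to \<open>(a ^ 4 - b ^ 4) / 4\<close>. The extrapolation is
  \<open>(a + b) / 2 - (a - 2 * b + c) / 2\<close>; its first part yields the quadratic part of the
  double well, and its second part, by polarization of \<open>a - b\<close> and \<open>b - c\<close>, the three squares.
\<close>

lemma double_well_increment:
  "(1/2 * (a\<^sup>2 + b\<^sup>2) * ((1/2) * (a + b)) - (1/2) * (3 * b - c)) * (a - b)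
    = f0 a - f0 b + ((a - b)\<^sup>2 - (b - c)\<^sup>2 + (a - 2 * b + c)\<^sup>2) / 4"
  unfolding f0_def by (simp add: field_simps power2_eq_square)

text \<open>
  Here \<open>v\<close> is the intermediate velocity, \<open>u\<close> and \<open>w\<close> are the velocities and \<open>g\<close> and \<open>q\<close> the pressure
  gradients at the old and the new level, and \<open>d\<close> is the time step. The terms in \<open>norm (q - g)\<close> that
  arise from the kinetic energy and from the pressure work cancel.
\<close>

lemma projection_increment:
  fixes u v w g q :: "'a::real_inner"
  assumes "v = w + (d/2) *\<^sub>R (q - g)"
  shows "(v - u) \<bullet> ((1/2) *\<^sub>R (v + u)) + d * (g \<bullet> ((1/2) *\<^sub>R (v + u)))
    = ((norm w)\<^sup>2 - (norm u)\<^sup>2) / 2 + d\<^sup>2 / 8 * ((norm q)\<^sup>2 - (norm g)\<^sup>2)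
      + d/2 * (q \<bullet> w) + d/2 * (g \<bullet> u)"
proof -
  have mid: "(v - u) \<bullet> ((1/2) *\<^sub>R (v + u)) = (v \<bullet> v - u \<bullet> u) / 2"
    by (simp add: inner_diff_left inner_add_right inner_diff_right inner_commute[of u v] field_simps)
  have vv: "v \<bullet> v = w \<bullet> w + d * (q \<bullet> w - g \<bullet> w) + d\<^sup>2 / 4 * (q \<bullet> q - 2 * (g \<bullet> q) + g \<bullet> g)"
  proof -
    have "v \<bullet> v = w \<bullet> w + d * ((q - g) \<bullet> w) + d\<^sup>2 / 4 * ((q - g) \<bullet> (q - g))"
      unfolding assms
      by (simp only: inner_add_left inner_add_right inner_scaleR_left inner_scaleR_right
          inner_commute[of w "q - g"]) (simp add: field_simps power2_eq_square)
    also have "(q - g) \<bullet> (q - g) = q \<bullet> q - 2 * (g \<bullet> q) + g \<bullet> g"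
      by (simp add: inner_diff_left inner_diff_right inner_commute[of q g])
    finally show ?thesis
      by (simp add: inner_diff_left)
  qed
  have gv: "g \<bullet> ((1/2) *\<^sub>R (v + u)) = (g \<bullet> w + g \<bullet> u) / 2 + d / 4 * (g \<bullet> q - g \<bullet> g)"
    unfolding assms by (simp add: inner_add_right inner_diff_right field_simps)
  show ?thesis
    unfolding mid vv gv power2_norm_eq_inner by (simp add: field_simps power2_eq_square)
qed

lemma norm_sqrt_scaled_squared: "s \<ge> 0 \<Longrightarrow> (sqrt s * norm g)\<^sup>2 = s * (g \<bullet> g)"
  by (simp add: power_mult_distrib power2_norm_eq_inner)

section \<open>The energy balance of one step\<close>

definition energy_density ::
  "real \<Rightarrow> real \<Rightarrow> real \<Rightarrow> (real^'n::finite \<Rightarrow> real^'n) \<Rightarrow>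
   (real^'n \<Rightarrow> real) \<Rightarrow> (real^'n \<Rightarrow> real) \<Rightarrow> (real^'n \<Rightarrow> real) \<Rightarrow> real^'n \<Rightarrow> real" where
  "energy_density \<epsilon> We \<delta>t u \<phi> \<phi>' p x =
     (norm (u x))\<^sup>2 / 2
     + inverse \<epsilon> / We * (f0 (\<phi> x) + \<epsilon>\<^sup>2 / 2 * (norm (grad \<phi> x))\<^sup>2 + (\<phi> x - \<phi>' x)\<^sup>2 / 4)
     + \<delta>t\<^sup>2 / 8 * (norm (grad p x))\<^sup>2"

lemma E_mod_eq_integral:
  assumes S: "open S" "bounded S" and "\<epsilon> > 0"
    and C1: "C1_on_nbhd (closure S) u" "C1_on_nbhd (closure S) \<phi>"
      "C1_on_nbhd (closure S) \<phi>'" "C1_on_nbhd (closure S) p"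
  shows "set_integrable lborel S (energy_density \<epsilon> We \<delta>t u \<phi> \<phi>' p)"
    and "E_mod S \<epsilon> We \<delta>t u \<phi> \<phi>' p = (LINT x:S|lborel. energy_density \<epsilon> We \<delta>t u \<phi> \<phi>' p x)"
proof -
  note cont = C1[THEN C1_on_nbhd_continuous] C1(2,4)[THEN C1_on_nbhd_continuous_grad]
  note integrable = set_integrable_continuous_closure[OF S(2,1)]
  let ?A = "\<lambda>x. (norm (u x))\<^sup>2 / 2"
  let ?B = "\<lambda>x. 1 / \<epsilon> * f0 (\<phi> x) + \<epsilon> / 2 * (norm (grad \<phi> x))\<^sup>2"
  let ?C = "\<lambda>x. (\<phi> x - \<phi>' x)\<^sup>2"
  let ?D = "\<lambda>x. (norm (grad p x))\<^sup>2"
  have int: "set_integrable lborel S ?A" "set_integrable lborel S ?B"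
    "set_integrable lborel S ?C" "set_integrable lborel S ?D"
    unfolding f0_def by (intro integrable continuous_intros cont; simp)+
  have dens: "energy_density \<epsilon> We \<delta>t u \<phi> \<phi>' p
      = (\<lambda>x. ?A x + 1 / We * ?B x + inverse \<epsilon> / (4 * We) * ?C x + \<delta>t\<^sup>2 / 8 * ?D x)"
    using \<open>\<epsilon> > 0\<close>
    by (cases "We = 0") (simp_all add: fun_eq_iff energy_density_def field_simps power2_eq_square)
  show "set_integrable lborel S (energy_density \<epsilon> We \<delta>t u \<phi> \<phi>' p)"
    unfolding dens by (intro set_integral_add(1) set_integrable_mult_right int)
  show "E_mod S \<epsilon> We \<delta>t u \<phi> \<phi>' p = (LINT x:S|lborel. energy_density \<epsilon> We \<delta>t u \<phi> \<phi>' p x)"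
    unfolding dens E_mod_def E_tot_def L2_norm_on_squared real_norm_def power2_abs
    using int by (simp only: set_integral_add set_integrable_mult_right set_integral_mult_right)
qed

text \<open>
  All equations of a step enter at a single point \<open>x\<close>. The letters \<open>a\<close>, \<open>b\<close>, \<open>c\<close> denote the phase
  field at the new, the current and the preceding level; \<open>w\<close>, \<open>u0\<close> the new and the current velocity;
  \<open>U\<close> the intermediate one, and \<open>v\<close> the midpoint; \<open>q\<close>, \<open>g\<close> the new and the current pressure.
  The weights of the six fields are those with which the tested equations are added.
\<close>

lemma energy_density_balance:
  fixes w u0 v ut :: "real^'n::finite \<Rightarrow> real^'n" and a b c m q g \<phi>t \<phi>h :: "real^'n \<Rightarrow> real"
  assumes x: "x \<in> K" and pos: "\<delta>t > 0" "M (\<phi>t x) \<ge> 0"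
    and \<phi>h: "\<phi>h = midstep a b" and \<phi>t: "\<phi>t = extrapolate b c" and v: "v = midstep U u0"
    and reg: "C2_on_nbhd K a" "C2_on_nbhd K b" "C1_on_nbhd K m"
      "C1_on_nbhd K c"
      "C1_on_nbhd K (\<lambda>y. M (\<phi>t y) *\<^sub>R grad m y)" "C2_on_nbhd K v" "C1_on_nbhd K ut"
      "C1_on_nbhd K w" "C1_on_nbhd K u0" "C1_on_nbhd K q" "C1_on_nbhd K g"
    and transport: "(a x - b x) / \<delta>t = divergence (\<lambda>y. M (\<phi>t y) *\<^sub>R grad m y - \<phi>t y *\<^sub>R v y) x"
    and potential: "m x = 1/2 * ((a x)\<^sup>2 + (b x)\<^sup>2) * \<phi>h x - \<phi>t x - \<epsilon>\<^sup>2 * laplacian \<phi>h x"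
    and momentum: "(1 / \<delta>t) *\<^sub>R (U x - u0 x) - (1 / Rey) *\<^sub>R vec_laplacian v x + convection ut v x
        = - grad g x - (inverse \<epsilon> / We * \<phi>t x) *\<^sub>R grad m x"
    and projection: "(1 / \<delta>t) *\<^sub>R (w x - U x) + (1/2) *\<^sub>R grad (\<lambda>y. q y - g y) x = 0"
    and solenoidal: "divergence w x = 0" "divergence u0 x = 0"
  shows "energy_density \<epsilon> We \<delta>t w a b q x - energy_density \<epsilon> We \<delta>t u0 b c g x
      + \<delta>t * (inverse \<epsilon> / We) * (norm (sqrt (M (\<phi>t x)) *\<^sub>R grad m x))\<^sup>2
      + \<delta>t * (1 / Rey) * (norm (jacobian v (at x)))\<^sup>2
      + inverse \<epsilon> / (4 * We) * (a x - 2 * b x + c x)\<^sup>2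
    = \<delta>t * (inverse \<epsilon> / We) * divergence (\<lambda>y. m y *\<^sub>R (M (\<phi>t y) *\<^sub>R grad m y - \<phi>t y *\<^sub>R v y)) x
      + inverse \<epsilon> / We * \<epsilon>\<^sup>2 * divergence (\<lambda>y. (a y - b y) *\<^sub>R grad \<phi>h y) x
      + \<delta>t * (1 / Rey) * divergence (viscous_flux v) x
      - \<delta>t / 2 * divergence (\<lambda>y. (v y \<bullet> v y) *\<^sub>R ut y) x
      - \<delta>t / 2 * divergence (\<lambda>y. q y *\<^sub>R w y) x
      - \<delta>t / 2 * divergence (\<lambda>y. g y *\<^sub>R u0 y) x"
proof -
  note C1 = reg(1,2,6)[THEN C2_on_nbhd_imp_C1] reg(3,4,5,7-)
  note diff = C1_on_nbhd_differentiable[OF _ x]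
  have C2h: "C2_on_nbhd K \<phi>h"
    unfolding \<phi>h using reg by (intro C2_on_nbhd_midstep)
  have C1t: "C1_on_nbhd K \<phi>t"
    unfolding \<phi>t using C1 by (intro C1_on_nbhd_extrapolate)
  \<comment> \<open>The weight is named so that it remains an atom for the arithmetic.\<close>
  define \<alpha> where "\<alpha> = inverse \<epsilon> / We"
  have D1: "divergence (\<lambda>y. m y *\<^sub>R (M (\<phi>t y) *\<^sub>R grad m y - \<phi>t y *\<^sub>R v y)) x
      = (norm (sqrt (M (\<phi>t x)) *\<^sub>R grad m x))\<^sup>2 - \<phi>t x * (grad m x \<bullet> v x) + m x * ((a x - b x) / \<delta>t)"
  proof -
    have "C1_on_nbhd K (\<lambda>y. M (\<phi>t y) *\<^sub>R grad m y - \<phi>t y *\<^sub>R v y)"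
      using C1 C1t by (intro C1_on_nbhd_diff C1_on_nbhd_scaleR[of K \<phi>t v])
    then show ?thesis
      using divergence_scaleR[OF diff[OF C1(4)] diff] pos(2)
      by (simp add: transport inner_diff_right norm_sqrt_scaled_squared)
  qed
  have D2: "divergence (\<lambda>y. (a y - b y) *\<^sub>R grad \<phi>h y) x
      = ((norm (grad a x))\<^sup>2 - (norm (grad b x))\<^sup>2) / 2 + (a x - b x) * laplacian \<phi>h x"
  proof -
    have "grad \<phi>h x = (1/2) *\<^sub>R (grad a x + grad b x)"
      unfolding \<phi>h using C1 by (intro grad_midstep diff)
    moreover have "grad (\<lambda>y. a y - b y) x = grad a x - grad b x"
      using diff C1 by (intro grad_diff)
    moreover have "divergence (\<lambda>y. (a y - b y) *\<^sub>R grad \<phi>h y) x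
        = grad (\<lambda>y. a y - b y) x \<bullet> grad \<phi>h x + (a x - b x) * divergence (grad \<phi>h) x"
      using C1 C2h by (intro divergence_scaleR diff C1_on_nbhd_diff C2_on_nbhd_grad)
    moreover have "(grad a x - grad b x) \<bullet> ((1/2) *\<^sub>R (grad a x + grad b x))
        = ((norm (grad a x))\<^sup>2 - (norm (grad b x))\<^sup>2) / 2"
      by (simp add: power2_norm_eq_inner inner_diff_left inner_add_right
          inner_commute[of "grad b x" "grad a x"] field_simps)
    ultimately show ?thesis
      by (simp only: laplacian_def)
  qed
  have D3: "vec_laplacian v x \<bullet> v x = divergence (viscous_flux v) x - (norm (jacobian v (at x)))\<^sup>2"
    using reg(6) x by (rule vec_laplacian_inner_self)
  have D4: "convection ut v x \<bullet> v x = divergence (\<lambda>y. (v y \<bullet> v y) *\<^sub>R ut y) x / 2"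
    using C1 by (intro convection_inner_self diff)
  have D5: "divergence (\<lambda>y. q y *\<^sub>R w y) x = grad q x \<bullet> w x"
    and D6: "divergence (\<lambda>y. g y *\<^sub>R u0 y) x = grad g x \<bullet> u0 x"
    using C1 solenoidal by (simp_all add: divergence_scaleR diff)

  have "U x = w x + (\<delta>t/2) *\<^sub>R (grad q x - grad g x)"
  proof -
    have "grad (\<lambda>y. q y - g y) x = grad q x - grad g x"
      using C1 by (intro grad_diff diff)
    then have "\<delta>t *\<^sub>R ((1 / \<delta>t) *\<^sub>R (w x - U x) + (1/2) *\<^sub>R (grad q x - grad g x)) = 0"
      using projection by simp
    then show ?thesis
      using pos(1) by (simp add: scaleR_add_right algebra_simps)
  qed
  from projection_increment[OF this, of "u0 x"]
  have kinetic: "(U x - u0 x) \<bullet> v x + \<delta>t * (grad g x \<bullet> v x)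
      = ((norm (w x))\<^sup>2 - (norm (u0 x))\<^sup>2) / 2 + \<delta>t\<^sup>2 / 8 * ((norm (grad q x))\<^sup>2 - (norm (grad g x))\<^sup>2)
        + \<delta>t/2 * divergence (\<lambda>y. q y *\<^sub>R w y) x + \<delta>t/2 * divergence (\<lambda>y. g y *\<^sub>R u0 y) x"
    unfolding D5 D6 by (simp add: v midstep_def)
  have "\<delta>t * (((1 / \<delta>t) *\<^sub>R (U x - u0 x) - (1 / Rey) *\<^sub>R vec_laplacian v x + convection ut v x) \<bullet> v x)
      = \<delta>t * ((- grad g x - (inverse \<epsilon> / We * \<phi>t x) *\<^sub>R grad m x) \<bullet> v x)"
    unfolding momentum ..
  then have work: "(U x - u0 x) \<bullet> v x - \<delta>t * (1 / Rey) * (vec_laplacian v x \<bullet> v x)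
      + \<delta>t * (convection ut v x \<bullet> v x)
      = - \<delta>t * (grad g x \<bullet> v x) - \<delta>t * (\<alpha> * \<phi>t x * (grad m x \<bullet> v x))"
    using pos(1)
    by (simp only: inner_add_left inner_diff_left inner_minus_left inner_scaleR_left \<alpha>_def[symmetric])
      (simp add: right_diff_distrib distrib_left)
  have "m x * (a x - b x) + \<epsilon>\<^sup>2 * laplacian \<phi>h x * (a x - b x)
      = f0 (a x) - f0 (b x) + ((a x - b x)\<^sup>2 - (b x - c x)\<^sup>2 + (a x - 2 * b x + c x)\<^sup>2) / 4"
    unfolding potential double_well_increment[symmetric]
    by (simp add: \<phi>h \<phi>t midstep_def extrapolate_def algebra_simps)
  then have phase: "\<alpha> * (f0 (a x) - f0 (b x)
        + ((a x - b x)\<^sup>2 - (b x - c x)\<^sup>2 + (a x - 2 * b x + c x)\<^sup>2) / 4)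
      = \<alpha> * (m x * (a x - b x) + \<epsilon>\<^sup>2 * laplacian \<phi>h x * (a x - b x))"
    by simp
  have D1': "\<delta>t * divergence (\<lambda>y. m y *\<^sub>R (M (\<phi>t y) *\<^sub>R grad m y - \<phi>t y *\<^sub>R v y)) x
      = \<delta>t * (norm (sqrt (M (\<phi>t x)) *\<^sub>R grad m x))\<^sup>2 - \<delta>t * (\<phi>t x * (grad m x \<bullet> v x))
        + m x * (a x - b x)"
    unfolding D1 using pos(1) by (simp add: field_simps)
  have \<alpha>4: "inverse \<epsilon> / (4 * We) = \<alpha> / 4"
    by (simp add: \<alpha>_def)
  show ?thesis
    using kinetic work phase arg_cong[OF D1', of "\<lambda>r. \<alpha> * r"] arg_cong[OF D2, of "\<lambda>r. \<alpha> * \<epsilon>\<^sup>2 * r"]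
    unfolding energy_density_def \<alpha>4 \<alpha>_def[symmetric] D3 D4
    by (simp add: algebra_simps add_divide_distrib diff_divide_distrib)
qed

text \<open>The outputs of a step satisfy what the next step requires of its data.\<close>

lemma admissible_data_step:
  assumes "admissible_data S n (\<phi> (k - 1)) (\<phi> k) (u (k - 1)) (u k) (p k)"
    and "scheme_step S n M \<epsilon> Rey We \<delta>t \<phi> \<mu> ub u p k"
  shows "admissible_data S n (\<phi> k) (\<phi> (k + 1)) (u k) (u (k + 1)) (p (k + 1))"
  using assms unfolding admissible_data_def scheme_step_def Let_def by blast

text \<open>
  The boundary conditions annihilate the normal components of the six fields: the conditions on the
  potential and the midpoint velocity that of the first, the conditions on the phase field at both
  levels that of the second, the vanishing midpoint velocity those of the viscous and the convective
  one, and the impermeability at both levels those of the two pressure fluxes.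
\<close>

lemma energy_law_step:
  fixes \<Omega> :: "(real^'n::finite) set"
  assumes dom: "regular_domain \<Omega> n" and pos: "\<epsilon> > 0" "\<delta>t > 0" "\<And>s. M s \<ge> 0"
    and data: "admissible_data \<Omega> n (\<phi> (k - 1)) (\<phi> k) (u (k - 1)) (u k) (p k)"
    and step: "scheme_step \<Omega> n M \<epsilon> Rey We \<delta>t \<phi> \<mu> ub u p k"
  shows "E_mod \<Omega> \<epsilon> We \<delta>t (u (k + 1)) (\<phi> (k + 1)) (\<phi> k) (p (k + 1))
      - E_mod \<Omega> \<epsilon> We \<delta>t (u k) (\<phi> k) (\<phi> (k - 1)) (p k)
      = - \<delta>t * (inverse \<epsilon> / We) *
          (L2_norm_on \<Omega> (\<lambda>x. sqrt (M (extrapolate (\<phi> k) (\<phi> (k - 1)) x)) *\<^sub>R grad (\<mu> k) x))\<^sup>2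
        - \<delta>t * (1 / Rey) *
          (L2_norm_on \<Omega> (\<lambda>x. jacobian (midstep (ub (k + 1)) (u k)) (at x)))\<^sup>2
        - inverse \<epsilon> / (4 * We) *
          (L2_norm_on \<Omega> (\<lambda>x. \<phi> (k + 1) x - 2 * \<phi> k x + \<phi> (k - 1) x))\<^sup>2"
proof -
  define a where "a = \<phi> (k + 1)"
  define b where "b = \<phi> k"
  define c where "c = \<phi> (k - 1)"
  define m where "m = \<mu> k"
  define w where "w = u (k + 1)"
  define u0 where "u0 = u k"
  define q where "q = p (k + 1)"
  define g where "g = p k"
  define \<phi>h where "\<phi>h = midstep a b"
  define \<phi>t where "\<phi>t = extrapolate b c"
  define v where "v = midstep (ub (k + 1)) u0"
  define ut where "ut = extrapolate u0 (u (k - 1))"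
  note defs = a_def b_def c_def m_def w_def u0_def q_def g_def \<phi>h_def \<phi>t_def v_def ut_def
  let ?K = "closure \<Omega>"
  have \<Omega>: "open \<Omega>" "bounded \<Omega>"
    using dom by (auto simp: regular_domain_def)
  note integrable = set_integrable_continuous_closure[OF \<Omega>(2,1)]
  have reg: "C2_on_nbhd ?K a" "C2_on_nbhd ?K b" "C1_on_nbhd ?K m" "C1_on_nbhd ?K c"
      "C1_on_nbhd ?K (\<lambda>y. M (\<phi>t y) *\<^sub>R grad m y)" "C2_on_nbhd ?K v" "C1_on_nbhd ?K ut"
      "C1_on_nbhd ?K w" "C1_on_nbhd ?K u0" "C1_on_nbhd ?K q" "C1_on_nbhd ?K g"
    using data step
    by (simp_all add: admissible_data_def scheme_step_def Let_def defs C1_on_nbhd_extrapolate C2_on_nbhd_imp_C1)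
  have bc: "grad a x \<bullet> n x = 0" "grad b x \<bullet> n x = 0" "grad m x \<bullet> n x = 0" "v x = 0"
      "w x \<bullet> n x = 0" "u0 x \<bullet> n x = 0" if "x \<in> frontier \<Omega>" for x
    using data step that
    by (simp_all add: admissible_data_def scheme_step_def Let_def defs)
  note C1 = reg(1,2,6)[THEN C2_on_nbhd_imp_C1] reg(3,4,5,7-)
  have C2h: "C2_on_nbhd ?K \<phi>h"
    unfolding \<phi>h_def using reg by (intro C2_on_nbhd_midstep)
  have C1t: "C1_on_nbhd ?K \<phi>t"
    unfolding \<phi>t_def using C1 by (intro C1_on_nbhd_extrapolate)
  have grad_\<phi>h: "grad \<phi>h x \<bullet> n x = 0" if "x \<in> frontier \<Omega>" for x
  proof -
    have "x \<in> ?K"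
      using that by (simp add: frontier_def)
    then have "grad \<phi>h x = (1/2) *\<^sub>R (grad a x + grad b x)"
      unfolding \<phi>h_def using C1 by (intro grad_midstep C1_on_nbhd_differentiable)
    then show ?thesis
      using bc[OF that] by (simp add: inner_add_left)
  qed

  let ?F1 = "\<lambda>y. m y *\<^sub>R (M (\<phi>t y) *\<^sub>R grad m y - \<phi>t y *\<^sub>R v y)"
  let ?F2 = "\<lambda>y. (a y - b y) *\<^sub>R grad \<phi>h y"
  let ?F3 = "viscous_flux v"
  let ?F4 = "\<lambda>y. (v y \<bullet> v y) *\<^sub>R ut y"
  let ?F5 = "\<lambda>y. q y *\<^sub>R w y"
  let ?F6 = "\<lambda>y. g y *\<^sub>R u0 y"
  have F: "C1_on_nbhd ?K ?F1" "C1_on_nbhd ?K ?F2" "C1_on_nbhd ?K ?F3"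
      "C1_on_nbhd ?K ?F4" "C1_on_nbhd ?K ?F5" "C1_on_nbhd ?K ?F6"
    using C1 C1t C2h reg(6)
    by (auto intro!: C1_on_nbhd_scaleR[of ?K m] C1_on_nbhd_scaleR[of ?K \<phi>t v]
        C1_on_nbhd_scaleR[of ?K "\<lambda>y. a y - b y"] C1_on_nbhd_scaleR[of ?K "\<lambda>y. v y \<bullet> v y"]
        C1_on_nbhd_scaleR[of ?K q] C1_on_nbhd_scaleR[of ?K g]
        C1_on_nbhd_diff C1_on_nbhd_inner C2_on_nbhd_grad C1_on_nbhd_viscous_flux)
  note intF = F[THEN C1_on_nbhd_continuous_divergence, THEN integrable]
  have no_flux: "(LINT x:\<Omega>|lborel. divergence ?F1 x) = 0" "(LINT x:\<Omega>|lborel. divergence ?F2 x) = 0"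
      "(LINT x:\<Omega>|lborel. divergence ?F3 x) = 0" "(LINT x:\<Omega>|lborel. divergence ?F4 x) = 0"
      "(LINT x:\<Omega>|lborel. divergence ?F5 x) = 0" "(LINT x:\<Omega>|lborel. divergence ?F6 x) = 0"
    using bc grad_\<phi>h
    by (auto intro!: integral_divergence_eq_0[OF dom] F
        simp: viscous_flux_def inner_diff_left inner_vec_def[of "vec_lambda _"])

  let ?E1 = "energy_density \<epsilon> We \<delta>t w a b q"
  let ?E0 = "energy_density \<epsilon> We \<delta>t u0 b c g"
  let ?D1 = "\<lambda>x. (norm (sqrt (M (\<phi>t x)) *\<^sub>R grad m x))\<^sup>2"
  let ?D2 = "\<lambda>x. (norm (jacobian v (at x)))\<^sup>2"
  let ?D3 = "\<lambda>x. (a x - 2 * b x + c x)\<^sup>2"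
  have int1: "set_integrable lborel \<Omega> ?E1" and E1: "E_mod \<Omega> \<epsilon> We \<delta>t w a b q = (LINT x:\<Omega>|lborel. ?E1 x)"
    using E_mod_eq_integral[OF \<Omega> pos(1)] C1 by blast+
  have int0: "set_integrable lborel \<Omega> ?E0" and E0: "E_mod \<Omega> \<epsilon> We \<delta>t u0 b c g = (LINT x:\<Omega>|lborel. ?E0 x)"
    using E_mod_eq_integral[OF \<Omega> pos(1)] C1 by blast+
  \<comment> \<open>The dissipation density is continuous as the inner product of the diffusive flux, whose
    regularity is assumed as a whole, with the gradient of the potential.\<close>
  have D1_eq: "?D1 = (\<lambda>x. (M (\<phi>t x) *\<^sub>R grad m x) \<bullet> grad m x)"
    using pos(3) by (simp add: norm_sqrt_scaled_squared)
  have intD: "set_integrable lborel \<Omega> ?D1" "set_integrable lborel \<Omega> ?D2" "set_integrable lborel \<Omega> ?D3"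
    subgoal
      unfolding D1_eq using C1
      by (intro integrable continuous_on_inner C1_on_nbhd_continuous_grad C1_on_nbhd_continuous)
    subgoal
      using C1 by (intro integrable continuous_on_jacobian)
    subgoal
      using C1 by (intro integrable continuous_intros C1_on_nbhd_continuous)
    done

  have balance: "?E1 x - ?E0 x + \<delta>t * (inverse \<epsilon> / We) * ?D1 x + \<delta>t * (1 / Rey) * ?D2 x
        + inverse \<epsilon> / (4 * We) * ?D3 x
      = \<delta>t * (inverse \<epsilon> / We) * divergence ?F1 x + inverse \<epsilon> / We * \<epsilon>\<^sup>2 * divergence ?F2 x
        + \<delta>t * (1 / Rey) * divergence ?F3 x - \<delta>t / 2 * divergence ?F4 x
        - \<delta>t / 2 * divergence ?F5 x - \<delta>t / 2 * divergence ?F6 x" if "x \<in> \<Omega>" for x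
  proof (rule energy_density_balance[OF _ pos(2,3) \<phi>h_def \<phi>t_def v_def reg])
    show "x \<in> ?K"
      using that closure_subset by blast
  qed (use that data step in \<open>simp_all add: admissible_data_def scheme_step_def Let_def defs\<close>)
  have "(LINT x:\<Omega>|lborel. ?E1 x - ?E0 x + \<delta>t * (inverse \<epsilon> / We) * ?D1 x + \<delta>t * (1 / Rey) * ?D2 x
        + inverse \<epsilon> / (4 * We) * ?D3 x)
      = (LINT x:\<Omega>|lborel. \<delta>t * (inverse \<epsilon> / We) * divergence ?F1 x + inverse \<epsilon> / We * \<epsilon>\<^sup>2 * divergence ?F2 x
        + \<delta>t * (1 / Rey) * divergence ?F3 x - \<delta>t / 2 * divergence ?F4 x
        - \<delta>t / 2 * divergence ?F5 x - \<delta>t / 2 * divergence ?F6 x)"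
    using balance \<Omega>(1) by (intro set_lebesgue_integral_cong) auto
  also have "\<dots> = 0"
    using intF no_flux
    by (simp only: set_integral_add set_integral_diff set_integrable_mult_right set_integral_mult_right)
  also have "(LINT x:\<Omega>|lborel. ?E1 x - ?E0 x + \<delta>t * (inverse \<epsilon> / We) * ?D1 x + \<delta>t * (1 / Rey) * ?D2 x
        + inverse \<epsilon> / (4 * We) * ?D3 x)
      = E_mod \<Omega> \<epsilon> We \<delta>t w a b q - E_mod \<Omega> \<epsilon> We \<delta>t u0 b c g
        + \<delta>t * (inverse \<epsilon> / We) * (LINT x:\<Omega>|lborel. ?D1 x)
        + \<delta>t * (1 / Rey) * (LINT x:\<Omega>|lborel. ?D2 x)
        + inverse \<epsilon> / (4 * We) * (LINT x:\<Omega>|lborel. ?D3 x)"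
    unfolding E0 E1 using int1 int0 intD
    by (simp only: set_integral_add set_integral_diff set_integrable_mult_right set_integral_mult_right)
  finally show ?thesis
    unfolding L2_norm_on_squared real_norm_def power2_abs defs[symmetric] by simp
qed

theorem proposition3p2:
  fixes \<Omega> :: "(real^'n::finite) set"
    and n :: "real^'n \<Rightarrow> real^'n"
    and M :: "real \<Rightarrow> real"
    and \<epsilon> Rey We \<delta>t m1 m2 :: real
    and \<phi> \<mu> p :: "nat \<Rightarrow> real^'n \<Rightarrow> real"
    and ub u :: "nat \<Rightarrow> real^'n \<Rightarrow> real^'n"
    and N :: nat
  assumes "CARD('n) = 2 \<or> CARD('n) = 3"
    and "regular_domain \<Omega> n"
    and "\<epsilon> > 0" and "Rey > 0" and "We > 0" and "\<delta>t > 0"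
    and "0 < m1" and "m1 \<le> m2" and "\<And>s. m1 \<le> M s \<and> M s \<le> m2"
    and "admissible_data \<Omega> n (\<phi> 0) (\<phi> 1) (u 0) (u 1) (p 1)"
    and "\<And>k. 1 \<le> k \<Longrightarrow> k < N \<Longrightarrow> scheme_step \<Omega> n M \<epsilon> Rey We \<delta>t \<phi> \<mu> ub u p k"
  shows "(\<forall>k. 1 \<le> k \<and> k < N \<longrightarrow>
      E_mod \<Omega> \<epsilon> We \<delta>t (u (k + 1)) (\<phi> (k + 1)) (\<phi> k) (p (k + 1))
      - E_mod \<Omega> \<epsilon> We \<delta>t (u k) (\<phi> k) (\<phi> (k - 1)) (p k)
      = - \<delta>t * (inverse \<epsilon> / We) *
          (L2_norm_on \<Omega> (\<lambda>x. sqrt (M (extrapolate (\<phi> k) (\<phi> (k - 1)) x)) *\<^sub>R grad (\<mu> k) x))\<^sup>2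
        - \<delta>t * (1 / Rey) *
          (L2_norm_on \<Omega> (\<lambda>x. jacobian (midstep (ub (k + 1)) (u k)) (at x)))\<^sup>2
        - inverse \<epsilon> / (4 * We) *
          (L2_norm_on \<Omega> (\<lambda>x. \<phi> (k + 1) x - 2 * \<phi> k x + \<phi> (k - 1) x))\<^sup>2)
    \<and> (\<forall>j k. 1 \<le> j \<and> j \<le> k \<and> k \<le> N \<longrightarrow>
      E_mod \<Omega> \<epsilon> We \<delta>t (u k) (\<phi> k) (\<phi> (k - 1)) (p k)
      \<le> E_mod \<Omega> \<epsilon> We \<delta>t (u j) (\<phi> j) (\<phi> (j - 1)) (p j))"
proof -
  have M: "M s \<ge> 0" for s
    using assms(7,9) by (meson less_le_trans less_imp_le)
  have data: "admissible_data \<Omega> n (\<phi> (k - 1)) (\<phi> k) (u (k - 1)) (u k) (p k)" if "1 \<le> k" "k \<le> N" for k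
    using that
  proof (induction k rule: dec_induct)
    case base
    show ?case using assms(10) by simp
  next
    case (step k)
    then have "admissible_data \<Omega> n (\<phi> k) (\<phi> (k + 1)) (u k) (u (k + 1)) (p (k + 1))"
      by (intro admissible_data_step[OF _ assms(11)]) auto
    then show ?case by simp
  qed
  note law = energy_law_step[OF assms(2,3,6) M data assms(11)]
  have decay: "E_mod \<Omega> \<epsilon> We \<delta>t (u (k + 1)) (\<phi> (k + 1)) (\<phi> k) (p (k + 1))
      \<le> E_mod \<Omega> \<epsilon> We \<delta>t (u k) (\<phi> k) (\<phi> (k - 1)) (p k)" if "1 \<le> k" "k < N" for k
  proof -
    have nonpos: "- \<delta>t * A * X\<^sup>2 - \<delta>t * B * Y\<^sup>2 - C * Z\<^sup>2 \<le> 0" if "A \<ge> 0" "B \<ge> 0" "C \<ge> 0" for A B C X Y Z :: real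
    proof -
      have "0 \<le> \<delta>t * A * X\<^sup>2 + \<delta>t * B * Y\<^sup>2 + C * Z\<^sup>2"
        using that assms(6) by simp
      then show ?thesis by simp
    qed
    have "E_mod \<Omega> \<epsilon> We \<delta>t (u (k + 1)) (\<phi> (k + 1)) (\<phi> k) (p (k + 1))
      - E_mod \<Omega> \<epsilon> We \<delta>t (u k) (\<phi> k) (\<phi> (k - 1)) (p k) \<le> 0"
      using that assms(3-5) by (intro ord_eq_le_trans[OF law] nonpos) simp_all
    then show ?thesis by simp
  qed
  have "E_mod \<Omega> \<epsilon> We \<delta>t (u k) (\<phi> k) (\<phi> (k - 1)) (p k)
      \<le> E_mod \<Omega> \<epsilon> We \<delta>t (u j) (\<phi> j) (\<phi> (j - 1)) (p j)" if "1 \<le> j" "j \<le> k" "k \<le> N" for j k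
    using that(2,3)
  proof (induction k rule: dec_induct)
    case (step i)
    then show ?case
      using decay[of i] that(1) by simp
  qed simp
  with law show ?thesis
    by (intro conjI allI impI) simp_all
qed

end
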